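(* Let $n\ge 1$ and let $f:\{0,1\}^n\to\{0,1\}$ be a Boolean function. The algorithm "Solving SAT with $OSM^*$" (described in the context), run on $f$ with access to a perfect $OSM^*$ black box, decides $\mathrm{SAT}$ for $f$: it outputs "satisfying assignment exists" if there is $\vec x\in\{0,1\}^n$ with $f(\vec x)=1$, and outputs "satisfying assignment does not exist" otherwise.
   Context: Notation: $|\pm\rangle=\frac{|0\rangle\pm|1\rangle}{\sqrt2}$; $|\psi_f\rangle=\frac{1}{\sqrt{2^n}}\sum_{\vec s\in\{0,1\}^n}(-1)^{f(\vec s)}|\vec s\rangle$; $\pm\{|\pm\rangle\}^{\otimes n}$ is the set of vectors $\varepsilon|\phi_1\rangle\otimes\cdots\otimes|\phi_n\rangle$ with $\varepsilon\in\{1,-1\}$ and each $|\phi_j\rangle\in\{|+\rangle,|-\rangle\}$. $U_f$ is the unitary on $n+1$ qubits with $U_f|x\rangle|y\rangle=|x\rangle|y\oplus f(x)\rangle$ for $x\in\{0,1\}^n$, $y\in\{0,1\}$. The $OSM^*$ black box, given a state of the form $|\psi_f\rangle$, answers (with certainty) "yes" if $|\psi_f\rangle\in\pm\{|\pm\rangle\}^{\otimes n}$ and "no" otherwise. The Deutsch–Jozsa algorithm, for a function $f$ that is either constant or balanced (takes each of the values $0$ and $1$ exactly $2^{n-1}$ times), prepares $|\psi_f\rangle$ by applying $U_f$ once to $|+\rangle^{\otimes n}|-\rangle$, measures the $n$ qubits each in the basis $\{|+\rangle,|-\rangle\}$, and declares $f$ constant if all outcomes are $+$ and balanced otherwise.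 Algorithm "Solving SAT with $OSM^*$" on input $f$: (1) Construct the quantum circuit implementing $U_f$ and apply $U_f$ to $|+\rangle^{\otimes n}|-\rangle$ to obtain $|\psi_f\rangle|-\rangle$. (2) Perform $OSM^*$ on $|\psi_f\rangle$. If the answer is "no", output "satisfying assignment exists" and stop; otherwise continue. (3) Apply the Deutsch–Jozsa algorithm to $f$. If it declares $f$ balanced, output "satisfying assignment exists" and stop; otherwise continue. (4) Apply $U_f$ to $|0\rangle^{\otimes n}|0\rangle$ and measure the last (ancilla) qubit in the basis $\{|0\rangle,|1\rangle\}$. If the outcome is $0$, output "satisfying assignment does not exist"; if it is $1$, output "satisfying assignment exists". *)

theory Defs
  imports "HOL-Analysis.Analysis" "HOL-Probability.Probability" "HOL-Library.Monad_Syntax"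
begin

text \<open>
  Bit strings of length \<open>n = CARD('n)\<close> are elements of \<open>bool^'n\<close>, with \<open>True\<close> for the bit 1,
  so that addition modulo 2 of bits is \<open>\<noteq>\<close>. The state space of a register whose
  computational basis is labelled by a finite type \<open>'a\<close> is \<open>complex^'a\<close>; hence one qubit lives in
  \<open>complex^bool\<close>, \<open>n\<close> qubits in \<open>complex^(bool^'n)\<close>, and \<open>n\<close> qubits with one further
  (ancilla) qubit in \<open>complex^((bool^'n) \<times> bool)\<close>.
\<close>

definition ket :: "'a::finite \<Rightarrow> complex^'a" where
  "ket x = axis x 1"

definition tensor :: "complex^'a::finite \<Rightarrow> complex^'b::finite \<Rightarrow> complex^('a \<times> 'b)"  (infixr \<open>\<otimes>\<close> 75)
  where "\<phi> \<otimes> \<eta> = (\<chi> p. \<phi> $ fst p * \<eta> $ snd p)"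

definition qubit_tensor :: "('n::finite \<Rightarrow> complex^bool) \<Rightarrow> complex^(bool^'n)" where
  "qubit_tensor \<phi> = (\<chi> s. \<Prod>j\<in>UNIV. \<phi> j $ (s $ j))"

definition ket_plus :: "complex^bool" where
  "ket_plus = (1 / complex_of_real (sqrt 2)) *s (ket False + ket True)"

definition ket_minus :: "complex^bool" where
  "ket_minus = (1 / complex_of_real (sqrt 2)) *s (ket False - ket True)"

definition ket_fun :: "(bool^'n::finite \<Rightarrow> bool) \<Rightarrow> complex^(bool^'n)" where
  "ket_fun f = (1 / complex_of_real (sqrt (2 ^ CARD('n)))) *s
     (\<Sum>s\<in>UNIV. (-1) ^ (of_bool (f s) :: nat) *s ket s)"

definition signed_plus_minus_states :: "(complex^(bool^'n::finite)) set" where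
  "signed_plus_minus_states =
     {\<epsilon> *s qubit_tensor \<phi> | \<epsilon> \<phi>. \<epsilon> \<in> {1, -1} \<and> (\<forall>j. \<phi> j \<in> {ket_plus, ket_minus})}"

text \<open>The column of \<open>U_gate f\<close> with label \<open>(x, y)\<close> is the basis vector with label
  \<open>(x, y \<noteq> f x)\<close>.\<close>

definition U_gate :: "(bool^'n::finite \<Rightarrow> bool) \<Rightarrow> complex^((bool^'n) \<times> bool)^((bool^'n) \<times> bool)" where
  "U_gate f = (\<chi> i j. (ket (fst j) \<otimes> ket (snd j \<noteq> f (fst j))) $ i)"

lemma ket_nth: "ket x $ y = (if y = x then 1 else 0)"
  by (simp add: ket_def axis_def)

lemma ket_tensor_ket: "ket x \<otimes> ket y = ket (x, y)"
  unfolding vec_eq_iff tensor_def by (auto simp: ket_nth)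

lemma flip_eq_iff:
  "(fst i, snd i \<noteq> f (fst i)) = (x, y) \<longleftrightarrow> i = (x, y \<noteq> f x)"
  by (cases "fst i = x"; cases y; cases "f x"; cases i) simp_all

lemma U_gate_nth: "U_gate f $ i $ j = (if j = (fst i, snd i \<noteq> f (fst i)) then 1 else 0)"
proof -
  have "j = (fst i, snd i \<noteq> f (fst i)) \<longleftrightarrow> i = (fst j, snd j \<noteq> f (fst j))"
    using flip_eq_iff[of i f "fst j" "snd j"] unfolding prod.collapse by (simp only: eq_commute)
  then show ?thesis
    unfolding U_gate_def vec_lambda_beta ket_tensor_ket ket_nth by (simp only:)
qed

lemma sum_delta_mult: "(\<Sum>j\<in>UNIV. (if j = c then 1 else 0) * g j) = (g c :: complex)"
  for c :: "'a::finite"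
  by (simp add: mult_if_delta)

lemma U_gate_ket: "U_gate f *v (ket x \<otimes> ket y) = ket x \<otimes> ket (y \<noteq> f x)"
proof -
  have "(U_gate f *v ket (x, y)) $ i = ket (x, y \<noteq> f x) $ i" for i
    unfolding matrix_vector_mult_def vec_lambda_beta U_gate_nth sum_delta_mult ket_nth flip_eq_iff ..
  then show ?thesis unfolding ket_tensor_ket vec_eq_iff by blast
qed

lemma U_gate_unitary:
  "transpose (map_matrix cnj (U_gate f)) ** U_gate f = mat 1"
  "U_gate f ** transpose (map_matrix cnj (U_gate f)) = mat 1"
proof -
  have "(U_gate f ** transpose (map_matrix cnj (U_gate f))) $ i $ k = mat 1 $ i $ k" for i k
  proof -
    have "(U_gate f ** transpose (map_matrix cnj (U_gate f))) $ i $ k =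
        (\<Sum>j\<in>UNIV. U_gate f $ i $ j * cnj (U_gate f $ k $ j))"
      by (simp add: matrix_matrix_mult_def transpose_def map_matrix_def)
    also have "\<dots> =
        cnj (if (fst i, snd i \<noteq> f (fst i)) = (fst k, snd k \<noteq> f (fst k)) then 1 else 0)"
      unfolding U_gate_nth sum_delta_mult ..
    also have "(fst i, snd i \<noteq> f (fst i)) = (fst k, snd k \<noteq> f (fst k)) \<longleftrightarrow> i = k"
      unfolding flip_eq_iff by (cases k; cases "f (fst k)") simp_all
    also have "cnj (if i = k then 1 else 0) = mat 1 $ i $ k"
      by (simp add: mat_def)
    finally show ?thesis .
  qed
  then show *: "U_gate f ** transpose (map_matrix cnj (U_gate f)) = mat 1"
    unfolding vec_eq_iff by blast
  then show "transpose (map_matrix cnj (U_gate f)) ** U_gate f = mat 1"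
    by (simp add: matrix_left_right_inverse)
qed

text \<open>
  Born rule for measuring one of two registers in an orthonormal basis \<open>b\<close>. The partial inner
  product \<open>bra_fst \<phi> \<Psi>\<close> is the vector obtained by applying the bra of \<open>\<phi>\<close> to the first register
  of \<open>\<Psi>\<close> and the identity to the second; \<open>bra_snd\<close> has the roles of the registers exchanged.
  \<open>embed_pmf\<close> is meaningful only when the weights sum to 1, which is the case if \<open>b\<close> is an
  orthonormal basis and \<open>\<Psi>\<close> is a unit vector.
\<close>

definition bra_fst :: "complex^'a::finite \<Rightarrow> complex^('a \<times> 'b::finite) \<Rightarrow> complex^'b" where
  "bra_fst \<phi> \<Psi> = (\<chi> y. \<Sum>x\<in>UNIV. cnj (\<phi> $ x) * \<Psi> $ (x, y))"

definition bra_snd :: "complex^'b::finite \<Rightarrow> complex^('a::finite \<times> 'b) \<Rightarrow> complex^'a" where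
  "bra_snd \<eta> \<Psi> = (\<chi> x. \<Sum>y\<in>UNIV. cnj (\<eta> $ y) * \<Psi> $ (x, y))"

definition measure_fst :: "('k \<Rightarrow> complex^'a::finite) \<Rightarrow> complex^('a \<times> 'b::finite) \<Rightarrow> 'k pmf" where
  "measure_fst b \<Psi> = embed_pmf (\<lambda>k. (norm (bra_fst (b k) \<Psi>))\<^sup>2)"

definition measure_snd :: "('k \<Rightarrow> complex^'b::finite) \<Rightarrow> complex^('a::finite \<times> 'b) \<Rightarrow> 'k pmf" where
  "measure_snd b \<Psi> = embed_pmf (\<lambda>k. (norm (bra_snd (b k) \<Psi>))\<^sup>2)"

text \<open>The state of the first register of a product state whose second register is in state
  \<open>\<eta>\<close>; the value is unspecified if \<open>\<Psi>\<close> is not of this form.\<close>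

definition first_register :: "complex^'b::finite \<Rightarrow> complex^('a::finite \<times> 'b) \<Rightarrow> complex^'a" where
  "first_register \<eta> \<Psi> = (THE \<phi>. \<Psi> = \<phi> \<otimes> \<eta>)"

lemma first_register_tensor:
  assumes "\<eta> \<noteq> 0"
  shows "first_register \<eta> (\<phi> \<otimes> \<eta>) = \<phi>"
  unfolding first_register_def
proof (rule the_equality)
  obtain y where "\<eta> $ y \<noteq> 0" using assms by (auto simp: vec_eq_iff)
  fix \<psi> assume "\<phi> \<otimes> \<eta> = \<psi> \<otimes> \<eta>"
  then have "\<phi> $ x * \<eta> $ y = \<psi> $ x * \<eta> $ y" for x
    by (auto simp: vec_eq_iff tensor_def)
  with \<open>\<eta> $ y \<noteq> 0\<close> show "\<psi> = \<phi>" by (auto simp: vec_eq_iff)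
qed simp

text \<open>A black box returns a random answer, \<open>True\<close> standing for ``yes''. Nothing is required on
  inputs that are not of the form \<open>ket_fun g\<close>.\<close>

definition perfect_OSM :: "(complex^(bool^'n::finite) \<Rightarrow> bool pmf) \<Rightarrow> bool" where
  "perfect_OSM osm \<longleftrightarrow>
     (\<forall>g. osm (ket_fun g) = return_pmf (ket_fun g \<in> signed_plus_minus_states))"

definition apply_U_plus_minus :: "(bool^'n::finite \<Rightarrow> bool) \<Rightarrow> complex^((bool^'n) \<times> bool)" where
  "apply_U_plus_minus f = U_gate f *v (qubit_tensor (\<lambda>_. ket_plus) \<otimes> ket_minus)"

datatype dj_verdict = Constant | Balanced

text \<open>The outcome of measuring each of the \<open>n\<close> qubits in the basis \<open>ket_plus\<close>, \<open>ket_minus\<close> is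
  encoded as a bit string in which \<open>False\<close> stands for \<open>+\<close> and \<open>True\<close> for \<open>-\<close>.\<close>

definition plus_minus_basis :: "bool^'n::finite \<Rightarrow> complex^(bool^'n)" where
  "plus_minus_basis r = qubit_tensor (\<lambda>j. if r $ j then ket_minus else ket_plus)"

definition deutsch_jozsa :: "(bool^'n::finite \<Rightarrow> bool) \<Rightarrow> dj_verdict pmf" where
  "deutsch_jozsa f = do {
     r \<leftarrow> measure_fst plus_minus_basis (apply_U_plus_minus f);
     return_pmf (if \<forall>j. \<not> r $ j then Constant else Balanced)
   }"

datatype sat_verdict = Assignment_Exists | No_Assignment_Exists

definition sat_with_OSM ::
  "(complex^(bool^'n::finite) \<Rightarrow> bool pmf) \<Rightarrow> (bool^'n \<Rightarrow> bool) \<Rightarrow> sat_verdict pmf" where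
  "sat_with_OSM osm f = do {
     answer \<leftarrow> osm (first_register ket_minus (apply_U_plus_minus f));
     if \<not> answer then return_pmf Assignment_Exists
     else do {
       verdict \<leftarrow> deutsch_jozsa f;
       if verdict = Balanced then return_pmf Assignment_Exists
       else do {
         b \<leftarrow> measure_snd ket (U_gate f *v (qubit_tensor (\<lambda>_. ket False) \<otimes> ket False));
         return_pmf (if b then Assignment_Exists else No_Assignment_Exists)
       }
     }
   }"

end

theory Submission
  imports Defs
begin

text \<open>
  Phase kickback gives \<open>U\<^sub>f (|+\<dots>+> |->) = |\<psi>\<^sub>f> |->\<close>. If the black box answers ``yes'', then
  \<open>|\<psi>\<^sub>f>\<close> is up to sign a member of the orthonormal basis measured by Deutsch--Jozsa, so the
  outcome is deterministic even though \<open>f\<close> is not promised to be constant or balanced: either the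
  outcome is not \<open>+\<dots>+\<close>, which cannot happen for \<open>f = 0\<close>, or \<open>f\<close> is constant and the
  last measurement reveals its value. The answer ``no'' rules out \<open>f = 0\<close>, since then
  \<open>|\<psi>\<^sub>f> = |+\<dots>+>\<close>.
\<close>

text \<open>Every measurement below is deterministic: recognising its weights as a point mass
  settles that \<open>embed_pmf\<close> is meaningful and gives the outcome.\<close>

lemma embed_pmf_of_bool: "embed_pmf (\<lambda>k. of_bool (k = r)) = return_pmf r"
proof -
  have "(\<lambda>k. of_bool (k = r)) = pmf (return_pmf r)"
    by (auto simp: fun_eq_iff)
  then show ?thesis
    by (simp only: type_definition.Rep_inverse[OF td_pmf_embed_pmf])
qed

lemma norm_vector_scalar_mult: "norm (c *s v) = norm c * norm v"
  for v :: "'a::real_normed_field^'n"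
  by (simp add: norm_vec_def norm_mult L2_set_right_distrib)

text \<open>Orthonormality kills every weight except that of \<open>r\<close>, and the global phase
  \<open>\<epsilon>\<close> disappears in the modulus.\<close>

lemma measure_fst_tensor:
  assumes "\<And>k l. (\<Sum>x\<in>UNIV. cnj (b k $ x) * b l $ x) = of_bool (k = l)"
    and "norm \<epsilon> = 1" "norm \<eta> = 1"
  shows "measure_fst b ((\<epsilon> *s b r) \<otimes> \<eta>) = return_pmf r"
proof -
  have "bra_fst (b k) ((\<epsilon> *s b r) \<otimes> \<eta>) = (\<epsilon> * of_bool (k = r)) *s \<eta>" for k
    by (simp add: vec_eq_iff bra_fst_def tensor_def sum_distrib_left sum_distrib_right
        mult_ac flip: assms(1))
  then have "(norm (bra_fst (b k) ((\<epsilon> *s b r) \<otimes> \<eta>)))\<^sup>2 = of_bool (k = r)" for k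
    using assms(2,3) by (simp add: norm_vector_scalar_mult norm_mult)
  then show ?thesis
    by (simp add: measure_fst_def embed_pmf_of_bool)
qed

lemma measure_snd_tensor:
  assumes "\<And>k l. (\<Sum>x\<in>UNIV. cnj (b k $ x) * b l $ x) = of_bool (k = l)"
    and "norm \<phi> = 1"
  shows "measure_snd b (\<phi> \<otimes> b r) = return_pmf r"
proof -
  have "bra_snd (b k) (\<phi> \<otimes> b r) = of_bool (k = r) *s \<phi>" for k
    by (simp add: vec_eq_iff bra_snd_def tensor_def sum_distrib_left sum_distrib_right
        mult_ac flip: assms(1))
  then have "(norm (bra_snd (b k) (\<phi> \<otimes> b r)))\<^sup>2 = of_bool (k = r)" for k
    using assms(2) by (simp add: norm_vector_scalar_mult)
  then show ?thesis
    by (simp add: measure_snd_def embed_pmf_of_bool)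
qed

lemma ket_orthonormal: "(\<Sum>x\<in>UNIV. cnj (ket k $ x) * ket l $ x) = of_bool (k = l)"
proof -
  have "cnj (ket k $ x) = (if x = k then 1 else 0)" for x
    by (simp add: ket_nth)
  then show ?thesis
    by (simp add: sum_delta_mult ket_nth)
qed

lemma norm_ket: "norm (ket x) = 1"
  by (simp add: ket_def)

lemma ket_plus_nth: "ket_plus $ b = 1 / complex_of_real (sqrt 2)"
  by (cases b) (simp_all add: ket_plus_def ket_nth)

lemma ket_minus_nth: "ket_minus $ b = (-1) ^ of_bool b / complex_of_real (sqrt 2)"
  by (cases b) (simp_all add: ket_minus_def ket_nth)

lemma norm_ket_minus: "norm ket_minus = 1"
  by (simp add: norm_vec_def L2_set_def UNIV_bool ket_minus_nth norm_divide power_divide)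

lemma ket_minus_nonzero: "ket_minus \<noteq> 0"
  using norm_ket_minus by fastforce

text \<open>The distributive law, used to factor inner products of product states qubit by
  qubit.\<close>

lemma sum_prod_vec: "(\<Sum>s\<in>UNIV. \<Prod>j\<in>UNIV. g j (s $ j)) = (\<Prod>j\<in>UNIV. \<Sum>b\<in>UNIV. g j b)"
  for g :: "'n::finite \<Rightarrow> 'b::finite \<Rightarrow> 'c::comm_semiring_1"
proof -
  have "bij_betw vec_nth (UNIV :: ('b^'n) set) UNIV"
    by (rule bij_betwI[where g = vec_lambda]) auto
  then have "(\<Sum>s\<in>UNIV. \<Prod>j\<in>UNIV. g j (s $ j)) = (\<Sum>h\<in>UNIV. \<Prod>j\<in>UNIV. g j (h j))"
    by (rule sum.reindex_bij_betw)
  then show ?thesis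
    by (simp add: prod_sum_PiE)
qed

text \<open>The inner product is a product of one-qubit inner products, so a single position where
  \<open>k\<close> and \<open>l\<close> differ makes it vanish.\<close>

lemma plus_minus_basis_orthonormal:
  "(\<Sum>s\<in>UNIV. cnj (plus_minus_basis k $ s) * plus_minus_basis l $ s) = of_bool (k = l)"
proof -
  let ?q = "\<lambda>c. if c then ket_minus else ket_plus"
  have qubit: "(\<Sum>b\<in>UNIV. cnj (?q c $ b) * ?q d $ b) = of_bool (c = d)" for c d
    by (cases c; cases d) (simp_all add: UNIV_bool ket_plus_nth ket_minus_nth flip: of_real_mult)
  have "(\<Sum>s\<in>UNIV. cnj (plus_minus_basis k $ s) * plus_minus_basis l $ s)
      = (\<Prod>j\<in>UNIV. \<Sum>b\<in>UNIV. cnj (?q (k $ j) $ b) * ?q (l $ j) $ b)"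
    by (simp add: plus_minus_basis_def qubit_tensor_def flip: prod.distrib sum_prod_vec)
  also have "\<dots> = of_bool (k = l)"
    by (auto simp: qubit vec_eq_iff)
  finally show ?thesis .
qed

lemma qubit_tensor_plus_nth:
  "qubit_tensor (\<lambda>_. ket_plus) $ (s :: bool^'n::finite)
     = 1 / complex_of_real (sqrt (2 ^ CARD('n)))"
  by (simp add: qubit_tensor_def ket_plus_nth power_one_over real_sqrt_power power_divide)

lemma ket_fun_nth:
  fixes f :: "bool^'n::finite \<Rightarrow> bool"
  shows "ket_fun f $ s = (-1) ^ of_bool (f s) / complex_of_real (sqrt (2 ^ CARD('n)))"
  by (simp add: ket_fun_def ket_nth mult_delta_right)

lemma plus_minus_basis_zero:
  "(\<And>j. \<not> r $ j) \<Longrightarrow> plus_minus_basis r = qubit_tensor (\<lambda>_. ket_plus)"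
  by (simp add: plus_minus_basis_def)

lemma ket_fun_False: "(\<And>x. \<not> f x) \<Longrightarrow> ket_fun f = qubit_tensor (\<lambda>_. ket_plus)"
  by (simp add: vec_eq_iff ket_fun_nth qubit_tensor_plus_nth)

lemma U_gate_mult_nth: "(U_gate f *v \<Psi>) $ (x, y) = \<Psi> $ (x, y \<noteq> f x)"
  unfolding matrix_vector_mult_def vec_lambda_beta U_gate_nth sum_delta_mult by simp

text \<open>Phase kickback: flipping the label of \<open>ket_minus\<close> changes its sign, so
  wherever \<open>f x\<close> holds the ancilla flip becomes a factor -1 on the amplitude of
  \<open>x\<close>.\<close>

lemma apply_U_plus_minus_eq: "apply_U_plus_minus f = ket_fun f \<otimes> ket_minus"
proof -
  have "apply_U_plus_minus f $ (x, y) = (ket_fun f \<otimes> ket_minus) $ (x, y)" for x y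
    by (cases y; cases "f x")
      (simp_all add: apply_U_plus_minus_def U_gate_mult_nth tensor_def qubit_tensor_plus_nth
        ket_fun_nth ket_minus_nth)
  then show ?thesis
    by (simp add: vec_eq_iff)
qed

text \<open>This replaces the usual promise on \<open>f\<close>: the verdict is certain as soon as
  \<open>ket_fun f\<close> is a vector of the measured basis up to phase.\<close>

lemma deutsch_jozsa_eq:
  assumes "ket_fun f = \<epsilon> *s plus_minus_basis r" "norm \<epsilon> = 1"
  shows "deutsch_jozsa f = return_pmf (if \<forall>j. \<not> r $ j then Constant else Balanced)"
  unfolding deutsch_jozsa_def apply_U_plus_minus_eq assms(1)
  by (simp add: measure_fst_tensor plus_minus_basis_orthonormal assms(2) norm_ket_minus
      bind_return_pmf)

lemma signed_plus_minus_statesE: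
  assumes "\<psi> \<in> signed_plus_minus_states"
  obtains \<epsilon> r where "\<epsilon> \<in> {1, -1}" "\<psi> = \<epsilon> *s plus_minus_basis r"
proof -
  obtain \<epsilon> \<phi> where \<epsilon>: "\<epsilon> \<in> {1, -1}" and \<psi>: "\<psi> = \<epsilon> *s qubit_tensor \<phi>"
    and \<phi>: "\<forall>j. \<phi> j \<in> {ket_plus, ket_minus}"
    using assms by (auto simp: signed_plus_minus_states_def)
  \<comment> \<open>The bit string marks the positions whose factor is \<open>ket_minus\<close>;
    every other factor must be \<open>ket_plus\<close>.\<close>
  have "\<phi> = (\<lambda>j. if (\<chi> j. \<phi> j = ket_minus) $ j then ket_minus else ket_plus)"
    using \<phi> by (auto simp: fun_eq_iff)
  then have "qubit_tensor \<phi> = plus_minus_basis (\<chi> j. \<phi> j = ket_minus)"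
    unfolding plus_minus_basis_def by (rule arg_cong)
  with \<epsilon> \<psi> that show thesis by metis
qed

lemma qubit_tensor_plus_mem: "qubit_tensor (\<lambda>_. ket_plus) \<in> signed_plus_minus_states"
  unfolding signed_plus_minus_states_def
  by (auto intro!: exI[of _ 1] exI[of _ "\<lambda>_. ket_plus"])

text \<open>The all-plus state has equal nonzero amplitudes, so comparing coordinates forces every
  sign of \<open>ket_fun f\<close> to be the same \<open>\<epsilon>\<close>.\<close>

lemma ket_fun_eq_signed_plus:
  assumes "ket_fun f = \<epsilon> *s qubit_tensor (\<lambda>_. ket_plus)"
  shows "f x = f y"
proof -
  have "(-1) ^ of_bool (f z) = \<epsilon>" for z
    using arg_cong[OF assms, of "\<lambda>v. v $ z"] by (simp add: ket_fun_nth qubit_tensor_plus_nth)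
  from this[of x] this[of y] show ?thesis
    by (cases "f x"; cases "f y") auto
qed

lemma qubit_tensor_ket: "qubit_tensor (\<lambda>j. ket (x $ j)) = ket x"
  by (auto simp: vec_eq_iff qubit_tensor_def ket_nth)

text \<open>The ancilla ends in a basis state, so this measurement evaluates \<open>f\<close> at the
  zero string; that suffices once \<open>f\<close> is known to be constant.\<close>

lemma measure_ancilla:
  fixes f :: "bool^'n::finite \<Rightarrow> bool"
  shows "measure_snd ket (U_gate f *v (qubit_tensor (\<lambda>_. ket False) \<otimes> ket False))
     = return_pmf (f (\<chi> _. False))"
  using qubit_tensor_ket[of "\<chi> _::'n. False"]
  by (simp add: U_gate_ket measure_snd_tensor ket_orthonormal norm_ket)

theorem theorem1:
  fixes f :: "bool^'n::finite \<Rightarrow> bool"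
    and osm :: "complex^(bool^'n) \<Rightarrow> bool pmf"
  assumes "perfect_OSM osm"
  shows "sat_with_OSM osm f =
    return_pmf (if \<exists>x. f x then Assignment_Exists else No_Assignment_Exists)"
proof -
  have osm: "osm (first_register ket_minus (apply_U_plus_minus f))
      = return_pmf (ket_fun f \<in> signed_plus_minus_states)"
    using assms
    by (simp add: perfect_OSM_def apply_U_plus_minus_eq first_register_tensor ket_minus_nonzero)
  note run = sat_with_OSM_def osm measure_ancilla bind_return_pmf
  show ?thesis
  proof (cases "ket_fun f \<in> signed_plus_minus_states")
    case False
    then have "\<exists>x. f x"
      using ket_fun_False[of f] qubit_tensor_plus_mem by metis
    with False show ?thesis
      by (simp add: run)
  next
    case True
    then obtain \<epsilon> r where \<epsilon>: "\<epsilon> \<in> {1, -1}" and r: "ket_fun f = \<epsilon> *s plus_minus_basis r"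
      by (rule signed_plus_minus_statesE)
    have dj: "deutsch_jozsa f = return_pmf (if \<forall>j. \<not> r $ j then Constant else Balanced)"
      using \<epsilon> by (intro deutsch_jozsa_eq[OF r]) auto
    show ?thesis
    proof (cases "\<forall>j. \<not> r $ j")
      case plus: True
      then have "f x = f (\<chi> _. False)" for x
        using r by (intro ket_fun_eq_signed_plus[of f \<epsilon>]) (simp add: plus_minus_basis_zero)
      then have "(\<exists>x. f x) = f (\<chi> _. False)"
        by blast
      with True plus show ?thesis
        by (simp add: run dj)
    next
      case minus: False
      have "\<exists>x. f x"
      proof (rule ccontr)
        assume "\<nexists>x. f x"
        \<comment> \<open>A second representation of \<open>ket_fun f\<close>, now with the zero
          string. It would make the same run return \<open>Constant\<close>, whereas
          \<open>r\<close> makes it return \<open>Balanced\<close>; comparing verdicts avoids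
          proving \<open>r\<close> unique.\<close>
        then have "ket_fun f = 1 *s plus_minus_basis (\<chi> _. False)"
          by (simp add: ket_fun_False plus_minus_basis_zero)
        from deutsch_jozsa_eq[OF this] have "deutsch_jozsa f = return_pmf Constant"
          by simp
        with dj minus show False
          by simp
      qed
      with True minus show ?thesis
        by (auto simp: run dj)
    qed
  qed
qed

end
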